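(* Consider the family of polynomials $\{D(B_{n,5},x)\}_{n\ge1}$. The set of limits of roots of this family consists of the part of the circle $|x+2|=1$ with real part at least $-\tfrac32-\tfrac{\sqrt2}{2}$, the portions of the hyperbola $(\Re(x)+1)^2-(\Im(x))^2=\tfrac12$ with $\Re(x)\notin\left[\tfrac{-3-\sqrt2}{2},\tfrac{-2-\sqrt2}{2}\right]$, and the portion of the curve $|x+1|^2=|x|$ with real part at most $-\tfrac32-\tfrac{\sqrt2}{2}$.
   Context: All graphs are finite and simple. For a graph $G=(V,E)$, a set $S\subseteq V$ is dominating if every vertex of $V\setminus S$ is adjacent to a vertex of $S$. Let $d(G,i)$ be the number of dominating sets of $G$ of size $i$; the domination polynomial is $D(G,x)=\sum_{i=\gamma(G)}^{|V|} d(G,i)x^i$, where $\gamma(G)$ is the minimum size of a dominating set. The generalized book graph $B_{n,5}$ has vertex set $\{u_1,u_2,u_3\}\cup\{v_i,w_i:1\le i\le n\}$ and edge set $\{u_1u_2,u_2u_3\}\cup\{u_3w_i,\ u_1v_i,\ v_iw_i:1\le i\le n\}$ ($n$ copies of $C_5$ sharing the path $u_1u_2u_3$). For a family $\{f_n(x)\}$ of complex polynomials, a number $z\in\mathbb{C}$ is a limit of roots of $\{f_n\}$ if either $f_n(z)=0$ for all sufficiently large $n$, or $z$ is a limit point of the union over $n$ of the sets of roots of $f_n$.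
   Formalization: The point x = 0 is added to the set of limits of roots: the empty set never dominates, so D(B_{n,5},0) = 0 for every n and 0 is a limit of roots, though it lies on none of the three curves. *)

theory Defs
  imports "HOL-Analysis.Analysis" "HOL-Computational_Algebra.Polynomial"
begin

type_synonym 'a graph = "'a set \<times> 'a set set"

abbreviation verts :: "'a graph \<Rightarrow> 'a set" where "verts \<equiv> fst"
abbreviation edges :: "'a graph \<Rightarrow> 'a set set" where "edges \<equiv> snd"

definition finite_simple_graph :: "'a graph \<Rightarrow> bool" where
  "finite_simple_graph G \<longleftrightarrow>
     finite (verts G) \<and> (\<forall>e\<in>edges G. e \<subseteq> verts G \<and> card e = 2)"

definition adjacent :: "'a graph \<Rightarrow> 'a \<Rightarrow> 'a \<Rightarrow> bool" where
  "adjacent G x y \<longleftrightarrow> {x, y} \<in> edges G"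

definition dominating :: "'a graph \<Rightarrow> 'a set \<Rightarrow> bool" where
  "dominating G S \<longleftrightarrow> S \<subseteq> verts G \<and> (\<forall>x\<in>verts G - S. \<exists>y\<in>S. adjacent G x y)"

definition num_dominating :: "'a graph \<Rightarrow> nat \<Rightarrow> nat" where
  "num_dominating G i = card {S. dominating G S \<and> card S = i}"

definition domination_number :: "'a graph \<Rightarrow> nat" where
  "domination_number G = Min (card ` {S. dominating G S})"

definition domination_poly :: "'a graph \<Rightarrow> complex poly" where
  "domination_poly G =
     (\<Sum>i = domination_number G..card (verts G). monom (of_nat (num_dominating G i)) i)"

datatype book_vertex = U nat | V nat | W nat

definition book5 :: "nat \<Rightarrow> book_vertex graph" where
  "book5 n =
     ({U 1, U 2, U 3} \<union> (\<Union>i\<in>{1..n}. {V i, W i}),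
      {{U 1, U 2}, {U 2, U 3}} \<union> (\<Union>i\<in>{1..n}. {{U 3, W i}, {U 1, V i}, {V i, W i}}))"

definition limit_of_roots :: "(nat \<Rightarrow> complex poly) \<Rightarrow> complex \<Rightarrow> bool" where
  "limit_of_roots f z \<longleftrightarrow>
     (\<exists>N. \<forall>n\<ge>N. poly (f n) z = 0) \<or> z islimpt (\<Union>n\<in>{1..}. {w. poly (f n) w = 0})"

lemma finite_simple_graph_book5: "finite_simple_graph (book5 n)"
  by (auto simp: finite_simple_graph_def book5_def)

text \<open>The empty set is never dominating, so 0 is a root of every domination polynomial of a
  nonempty graph and hence a limit of roots, although it lies on none of the circle,
  the hyperbola and the curve that carry the other limits.\<close>

lemma limit_of_roots_book5_zero: "limit_of_roots (\<lambda>n. domination_poly (book5 n)) 0"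
proof -
  have "poly (domination_poly (book5 n)) 0 = 0" for n
  proof -
    have fin: "finite (verts (book5 n))"
      using finite_simple_graph_book5 by (auto simp: finite_simple_graph_def)
    have "{S. dominating (book5 n) S \<and> card S = 0} = {}"
    proof -
      have "\<not> dominating (book5 n) S" if "card S = 0" for S
      proof
        assume d: "dominating (book5 n) S"
        then have "S = {}"
          using that fin by (auto simp: dominating_def dest: finite_subset)
        then show False
          using d by (auto simp: dominating_def book5_def)
      qed
      then show ?thesis by blast
    qed
    then have n0: "num_dominating (book5 n) 0 = 0"
      unfolding num_dominating_def by (simp only: card.empty)
    show ?thesis
      unfolding domination_poly_def poly_sum poly_monom
      by (rule sum.neutral) (metis n0 mult_eq_0_iff of_nat_0 power_eq_0_iff neq0_conv)
  qed
  then show ?thesis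
    by (simp add: limit_of_roots_def)
qed

end

theory Submission
  imports Defs "HOL-Complex_Analysis.Complex_Analysis"
begin

text \<open>
  Sorting the dominating sets by their trace on the common path gives
  \[D(B_{n,5},x) = x^2(1+x)\,((1+x)^2)^n + x(2x+3)\,(x(x+2))^n - 2x\,x^n,\]
  so the claim is an instance of the Beraha--Kahane--Weiss theorem. If one base strictly dominates at
  \<open>z\<close>, its term prevents zeros near \<open>z\<close> for large \<open>n\<close>. Conversely, suppose that a convex open set
  is free of zeros but meets the dominance regions of two bases. There the \<open>n\<close>-th sum has a
  holomorphic \<open>n\<close>-th root, these roots are locally bounded, and by Montel a subsequence converges to
  some \<open>g\<close> whose modulus is that of the dominating base on each dominance region. On one region
  \<open>g\<close> is therefore a unimodular multiple of that base, by the identity theorem it is so everywhere,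
  and this contradicts the modulus of \<open>g\<close> on the other region.
\<close>

subsection \<open>Zeros of sums of powers\<close>

text \<open>The hypothesis under which one term governs the sum: the base \<open>l i w\<close> beats
  all others strictly in modulus, and its coefficient does not vanish. The nonzero base permits
  division by its powers.\<close>

definition dominates ::
    "'i set \<Rightarrow> ('i \<Rightarrow> complex \<Rightarrow> complex) \<Rightarrow> ('i \<Rightarrow> complex \<Rightarrow> complex) \<Rightarrow> 'i \<Rightarrow> complex \<Rightarrow> bool" where
  "dominates I \<alpha> l i w \<longleftrightarrow> i \<in> I \<and> \<alpha> i w \<noteq> 0 \<and> l i w \<noteq> 0 \<and>
     (\<forall>j\<in>I - {i}. cmod (l j w) < cmod (l i w))"

lemma open_dominates:
  assumes "finite I" "open S"
    and \<alpha>: "\<And>i. i \<in> I \<Longrightarrow> continuous_on S (\<alpha> i)" and l: "\<And>i. i \<in> I \<Longrightarrow> continuous_on S (l i)"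
  shows "open {w \<in> S. dominates I \<alpha> l i w}"
proof (cases "i \<in> I")
  case True
  have "{w \<in> S. dominates I \<alpha> l i w} =
      {w \<in> S. \<alpha> i w \<noteq> 0} \<inter> {w \<in> S. l i w \<noteq> 0} \<inter> S \<inter> (\<Inter>j\<in>I - {i}. {w \<in> S. 0 < cmod (l i w) - cmod (l j w)})"
    using True by (auto simp: dominates_def)
  also have "open \<dots>"
  proof (intro open_Int open_INT ballI)
    show "open {w \<in> S. \<alpha> i w \<noteq> 0}" "open {w \<in> S. l i w \<noteq> 0}"
      using continuous_open_preimage[OF \<alpha>[OF True] \<open>open S\<close>, of "-{0}"]
        continuous_open_preimage[OF l[OF True] \<open>open S\<close>, of "-{0}"]
      by (simp_all add: vimage_def Int_def open_Compl)
    show "open {w \<in> S. 0 < cmod (l i w) - cmod (l j w)}" if "j \<in> I - {i}" for j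
      using continuous_open_preimage[of S "\<lambda>w. cmod (l i w) - cmod (l j w)" "{0<..}"] that True
      by (simp add: vimage_def Int_def continuous_intros l \<open>open S\<close>)
  qed (use assms in auto)
  finally show ?thesis .
qed (simp add: dominates_def)

lemma power_sum_ratio_tendsto:
  assumes "finite I" "dominates I \<alpha> l i w"
  shows "(\<lambda>n. (\<Sum>j\<in>I. \<alpha> j w * l j w ^ n) / l i w ^ n) \<longlonglongrightarrow> \<alpha> i w"
proof -
  have i: "i \<in> I" and nz: "l i w \<noteq> 0" using assms by (auto simp: dominates_def)
  have "(\<lambda>n. \<alpha> j w * (l j w / l i w) ^ n) \<longlonglongrightarrow> (if j = i then \<alpha> j w else 0)" if "j \<in> I" for j
  proof (cases "j = i")
    case False
    then have "cmod (l j w / l i w) < 1"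
      using assms that by (auto simp: dominates_def norm_divide divide_simps)
    then have "(\<lambda>n. \<alpha> j w * (l j w / l i w) ^ n) \<longlonglongrightarrow> \<alpha> j w * 0"
      by (intro tendsto_intros LIMSEQ_power_zero) auto
    then show ?thesis using False by simp
  qed (use nz in simp)
  then have "(\<lambda>n. \<Sum>j\<in>I. \<alpha> j w * (l j w / l i w) ^ n) \<longlonglongrightarrow> (\<Sum>j\<in>I. if j = i then \<alpha> j w else 0)"
    by (intro tendsto_sum)
  moreover have "(\<Sum>j\<in>I. if j = i then \<alpha> j w else 0) = \<alpha> i w"
    using i assms(1) by simp
  ultimately show ?thesis
    by (simp add: sum_divide_distrib power_divide)
qed

text \<open>The sum divided by \<open>l i w ^ n\<close> tends to the nonzero number
  \<open>\<alpha> i w\<close>, and n-th roots of quantities with a positive limit tend to 1. The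
  choice of the root \<open>k n\<close> is immaterial since only its modulus enters.\<close>

lemma power_sum_nth_root_tendsto:
  assumes "finite I" "dominates I \<alpha> l i w"
    and k: "\<And>n. n > 0 \<Longrightarrow> k n ^ n = (\<Sum>j\<in>I. \<alpha> j w * l j w ^ n)"
  shows "(\<lambda>n. cmod (k n)) \<longlonglongrightarrow> cmod (l i w)"
proof -
  have nz: "l i w \<noteq> 0" and \<alpha>: "\<alpha> i w \<noteq> 0" using assms by (auto simp: dominates_def)
  let ?x = "\<lambda>n. (\<Sum>j\<in>I. \<alpha> j w * l j w ^ n) / l i w ^ n"
  \<comment> \<open>A positive limit raised to an exponent tending to 0 gives 1; this is where the
    nonvanishing of \<open>\<alpha> i w\<close> enters.\<close>
  have "(\<lambda>n. cmod (?x n) powr (1 / real n)) \<longlonglongrightarrow> cmod (\<alpha> i w) powr 0"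
    using power_sum_ratio_tendsto[OF assms(1,2)] \<alpha>
    by (intro tendsto_powr tendsto_norm lim_1_over_n) auto
  then have "(\<lambda>n. cmod (?x n) powr (1 / real n) * cmod (l i w)) \<longlonglongrightarrow> 1 * cmod (l i w)"
    using \<alpha> by (intro tendsto_intros) auto
  moreover have "\<forall>\<^sub>F n in sequentially. cmod (?x n) powr (1 / real n) * cmod (l i w) = cmod (k n)"
    using eventually_gt_at_top[of 0]
  proof eventually_elim
    case (elim n)
    then have "cmod (?x n) = (cmod (k n) / cmod (l i w)) ^ n"
      by (simp add: k[symmetric] norm_divide norm_power power_divide)
    also have "\<dots> powr (1 / real n) = cmod (k n) / cmod (l i w)"
      using elim by (simp add: powr_powr flip: powr_realpow')
    finally show ?case using nz by simp
  qed
  ultimately show ?thesis by (simp add: tendsto_cong)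
qed

text \<open>Convexity of \<open>S\<close> serves twice: it provides a holomorphic logarithm of a
  zero-free function, and connectedness for the identity theorem.\<close>

lemma power_sum_has_zero:
  assumes fin: "finite I" and S: "open S" "convex S"
    and \<alpha>: "\<And>i. i \<in> I \<Longrightarrow> \<alpha> i holomorphic_on S" and l: "\<And>i. i \<in> I \<Longrightarrow> l i holomorphic_on S"
    and a: "a \<in> S" "dominates I \<alpha> l i a" and b: "b \<in> S" "dominates I \<alpha> l j b" and ij: "i \<noteq> j"
  shows "\<exists>n>0. \<exists>w\<in>S. (\<Sum>j\<in>I. \<alpha> j w * l j w ^ n) = 0"
proof (rule ccontr)
  assume contra: "\<not> ?thesis"
  define f where "f = (\<lambda>n w. \<Sum>j\<in>I. \<alpha> j w * l j w ^ n)"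
  have iI: "i \<in> I" using a by (simp add: dominates_def)
  have f_nz: "f n w \<noteq> 0" if "n > 0" "w \<in> S" for n w
    using contra that unfolding f_def by blast
  have f_hol: "f n holomorphic_on S" for n
    unfolding f_def by (intro holomorphic_intros \<alpha> l)
  \<comment> \<open>An n-th root of the zero-free sum is exp(g / n) for a holomorphic logarithm
    g.\<close>
  have "\<exists>k. k holomorphic_on S \<and> (\<forall>w\<in>S. k w ^ n = f n w)" if "n > 0" for n
  proof -
    obtain g where g: "g holomorphic_on S" "\<And>w. w \<in> S \<Longrightarrow> f n w = exp (g w)"
      using contractible_imp_holomorphic_log[of "f n" S, OF f_hol convex_imp_contractible[OF S(2)]] f_nz \<open>n > 0\<close> by metis
    have "(\<lambda>w. exp (g w / of_nat n)) holomorphic_on S"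
      using that by (intro holomorphic_intros g) auto
    moreover have "exp (g w / of_nat n) ^ n = f n w" if "w \<in> S" for w
      using that \<open>n > 0\<close> g by (simp flip: exp_of_nat_mult)
    ultimately show ?thesis by blast
  qed
  then obtain k where k: "\<And>n. n > 0 \<Longrightarrow> k n holomorphic_on S"
      "\<And>n w. n > 0 \<Longrightarrow> w \<in> S \<Longrightarrow> k n w ^ n = f n w"
    by metis
  \<comment> \<open>Local boundedness for Montel. The shift to \<open>Suc n\<close> leaves out the
    index 0, which has no root.\<close>
  have bdd: "\<exists>B. \<forall>h \<in> range (\<lambda>n. k (Suc n)). \<forall>w\<in>K. cmod (h w) \<le> B" if K: "compact K" "K \<subseteq> S" for K
  proof -
    have bd: "\<exists>B. \<forall>w\<in>K. cmod (g w) \<le> B" if "g holomorphic_on S" for g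
    proof -
      have "continuous_on K g"
        using that K by (meson continuous_on_subset holomorphic_on_imp_continuous_on)
      then have "bounded (g ` K)" using K compact_continuous_image compact_imp_bounded by blast
      then show ?thesis by (auto simp: bounded_iff)
    qed
    obtain B where B: "\<And>i w. i \<in> I \<Longrightarrow> w \<in> K \<Longrightarrow> cmod (\<alpha> i w) \<le> B i" 
      using bd[OF \<alpha>] by metis
    obtain C where C: "\<And>i w. i \<in> I \<Longrightarrow> w \<in> K \<Longrightarrow> cmod (l i w) \<le> C i" 
      using bd[OF l] by metis
    \<comment> \<open>The summand 1 forces \<open>B'\<close> to be at least 1, so \<open>B'\<close>
      is at most \<open>B' ^ n\<close> and the coefficient bound survives the n-th root uniformly in
      n.\<close>
    define B' where "B' = 1 + (\<Sum>i\<in>I. \<bar>B i\<bar>)"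
    define C' where "C' = (\<Sum>i\<in>I. \<bar>C i\<bar>)"
    have B'1: "1 \<le> B'" by (simp add: B'_def sum_nonneg)
    have C'0: "0 \<le> C'" by (simp add: C'_def sum_nonneg)
    have "cmod (k n w) \<le> B' * C'" if n: "n > 0" and w: "w \<in> K" for n w
    proof -
      have "cmod (l i w) \<le> C'" if "i \<in> I" for i
        using C[OF that w] member_le_sum[OF that _ fin, of "\<lambda>i. \<bar>C i\<bar>"] by (simp add: C'_def)
      then have "cmod (\<alpha> i w * l i w ^ n) \<le> \<bar>B i\<bar> * C' ^ n" if "i \<in> I" for i
        unfolding norm_mult norm_power using that B[OF that w]
        by (intro mult_mono power_mono) auto
      then have "cmod (f n w) \<le> (\<Sum>i\<in>I. \<bar>B i\<bar> * C' ^ n)"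
        unfolding f_def by (rule sum_norm_le)
      also have "\<dots> \<le> B' * C' ^ n"
        unfolding sum_distrib_right[symmetric] using C'0 by (intro mult_right_mono) (auto simp: B'_def)
      also have "\<dots> \<le> B' ^ n * C' ^ n"
        using B'1 C'0 n self_le_power[of B' n] by (intro mult_right_mono) auto
      finally have "cmod (k n w) ^ n \<le> (B' * C') ^ n"
        using k(2)[OF n, of w] w K by (auto simp: norm_power[symmetric] power_mult_distrib)
      then show ?thesis
        using power_le_imp_le_base[of "cmod (k n w)" "n - 1" "B' * C'"] n B'1 C'0 by simp
    qed
    then show ?thesis by auto
  qed
  obtain g r where g: "g holomorphic_on S" and r: "strict_mono (r :: nat \<Rightarrow> nat)"
    and lim: "\<And>x. x \<in> S \<Longrightarrow> (\<lambda>n. k (Suc (r n)) x) \<longlonglongrightarrow> g x"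
  proof (rule Montel[of S "range (\<lambda>n. k (Suc n))" "\<lambda>n. k (Suc n)"])
  qed (use S k(1) bdd in auto)
  have g_norm: "cmod (g w) = cmod (l m w)" if "w \<in> S" "dominates I \<alpha> l m w" for m w
  proof (rule LIMSEQ_unique)
    show "(\<lambda>n. cmod (k (Suc (r n)) w)) \<longlonglongrightarrow> cmod (g w)"
      by (intro tendsto_norm lim that)
    have "(\<lambda>n. cmod (k n w)) \<longlonglongrightarrow> cmod (l m w)"
      using power_sum_nth_root_tendsto[OF fin that(2), of "\<lambda>n. k n w"] k(2) that by (auto simp: f_def)
    then show "(\<lambda>n. cmod (k (Suc (r n)) w)) \<longlonglongrightarrow> cmod (l m w)"
      using LIMSEQ_subseq_LIMSEQ[OF LIMSEQ_Suc r] by (fastforce simp: o_def)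
  qed
  have "open {w \<in> S. dominates I \<alpha> l i w}"
    using \<alpha> l by (intro open_dominates fin S holomorphic_on_imp_continuous_on)
  then obtain e where e: "e > 0" and ball: "ball a e \<subseteq> {w \<in> S. dominates I \<alpha> l i w}"
    using a by (auto elim!: openE)
  have nz: "l i w \<noteq> 0" if "w \<in> ball a e" for w
    using ball that by (auto simp: dominates_def)
  have norm1: "cmod (g w / l i w) = 1" if "w \<in> ball a e" for w
    using g_norm[of w i] ball that nz[OF that] by (auto simp: norm_divide)
  \<comment> \<open>The quotient has modulus 1 throughout the ball, so its modulus has an interior
    maximum at the centre.\<close>
  have "(\<lambda>w. g w / l i w) constant_on ball a e"
  proof (rule maximum_modulus_principle)
    show "(\<lambda>w. g w / l i w) holomorphic_on ball a e"
      using ball nz by (intro holomorphic_intros holomorphic_on_subset[OF g] holomorphic_on_subset[OF l[OF iI]]) auto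
    show "cmod (g w / l i w) \<le> cmod (g a / l i a)" if "w \<in> ball a e" for w
      using norm1[OF that] norm1[of a] e by simp
    show "a \<in> ball a e" using e by simp
  qed auto
  then obtain c where c: "\<And>w. w \<in> ball a e \<Longrightarrow> g w / l i w = c"
    by (auto simp: constant_on_def)
  have "g b = c * l i b"
  proof (rule analytic_continuation_open[of "ball a e" S g "\<lambda>w. c * l i w"])
    fix w assume "w \<in> ball a e"
    then show "g w = c * l i w"
      using c[of w] nz[of w] by (auto simp: field_simps)
  next
    show "connected S" using S by (simp add: convex_connected)
    show "(\<lambda>w. c * l i w) holomorphic_on S" by (intro holomorphic_intros l iI)
  qed (use S g e b ball in auto)
  moreover have "cmod c = 1" using c[of a] norm1[of a] e by simp
  ultimately have "cmod (l j b) = cmod (l i b)"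
    using g_norm[OF b] by (simp add: norm_mult)
  \<comment> \<open>Dominance of \<open>j\<close> at \<open>b\<close> makes the two moduli
    differ.\<close>
  then show False using b ij iI by (auto simp: dominates_def)
qed

text \<open>A limit point needs zeros other than \<open>z\<close> itself. Hence zeros are sought in
  a ball around \<open>z\<close> cut by a half-plane that excludes \<open>z\<close> but still meets
  both dominance regions.\<close>

lemma islimpt_power_sum_zeros:
  assumes fin: "finite I"
    and \<alpha>: "\<And>i. i \<in> I \<Longrightarrow> \<alpha> i holomorphic_on UNIV" and l: "\<And>i. i \<in> I \<Longrightarrow> l i holomorphic_on UNIV"
    and near: "\<And>e. e > 0 \<Longrightarrow> \<exists>i j a b. i \<noteq> j \<and> dist a z < e \<and> dominates I \<alpha> l i a \<and>
        dist b z < e \<and> dominates I \<alpha> l j b"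
  shows "z islimpt (\<Union>n\<in>{1..}. {w. (\<Sum>j\<in>I. \<alpha> j w * l j w ^ n) = 0})"
  unfolding islimpt_approachable
proof (intro allI impI)
  fix e :: real assume "e > 0"
  then obtain i j a0 b0 where ij: "i \<noteq> j" and a0: "dist a0 z < e" "dominates I \<alpha> l i a0"
    and b0: "dist b0 z < e" "dominates I \<alpha> l j b0"
    using near by metis
  define R where "R = (\<lambda>m. ball z e \<inter> {w. dominates I \<alpha> l m w})"
  have R: "open (R m)" for m
    unfolding R_def using open_dominates[OF fin open_UNIV, of \<alpha> l m] \<alpha> l
    by (intro open_Int) (auto intro: holomorphic_on_imp_continuous_on)
  have "a0 \<in> R i" "b0 \<in> R j" using a0 b0 by (auto simp: R_def dist_commute)
  \<comment> \<open>Both regions are open, so \<open>a\<close> can be moved off \<open>z\<close>,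
    and then \<open>b\<close> off the line through \<open>a\<close> and \<open>z\<close>, which has
    empty interior.\<close>
  obtain a where a: "a \<in> R i" "a \<noteq> z"
    using R[of i] \<open>a0 \<in> R i\<close> not_open_singleton[of z] by (cases "R i = {z}") auto
  have "interior (affine hull {a, z}) = {}"
    by (rule empty_interior_affine_hull) (auto simp: card_insert_if)
  then obtain b where b: "b \<in> R j" "b \<notin> affine hull {a, z}"
    using interior_maximal[OF _ R] \<open>b0 \<in> R j\<close> by blast
  \<comment> \<open>Otherwise \<open>b\<close> would be an affine combination of \<open>a\<close>
    and \<open>z\<close>.\<close>
  have "z \<notin> closed_segment a b"
  proof
    assume "z \<in> closed_segment a b"
    then obtain u where u: "z = (1 - u) *\<^sub>R a + u *\<^sub>R b" by (auto simp: closed_segment_def)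
    with a have "u \<noteq> 0" by auto
    then have "b = (1 - 1 / u) *\<^sub>R a + (1 / u) *\<^sub>R z"
      by (simp add: u algebra_simps)
    then have "b \<in> affine hull {a, z}" unfolding affine_hull_2
      by (intro CollectI exI[of _ "1 - 1 / u"] exI[of _ "1 / u"]) simp
    then show False using b by simp
  qed
  \<comment> \<open>Strict separation of \<open>z\<close> from the segment yields the
    half-plane.\<close>
  then obtain d \<beta> where d: "d \<bullet> z < \<beta>" "\<And>x. x \<in> closed_segment a b \<Longrightarrow> \<beta> < d \<bullet> x"
    using separating_hyperplane_closed_point[of "closed_segment a b" z] by auto
  define S where "S = ball z e \<inter> {x. \<beta> < d \<bullet> x}"
  have S: "open S" "convex S"
    unfolding S_def using open_halfspace_gt[of \<beta> d] convex_halfspace_gt[of \<beta> d] by (auto intro: convex_Int)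
  have "a \<in> S" "b \<in> S" using a b d by (auto simp: S_def R_def)
  have "\<exists>n>0. \<exists>w\<in>S. (\<Sum>j\<in>I. \<alpha> j w * l j w ^ n) = 0"
  proof (rule power_sum_has_zero)
    show "\<alpha> m holomorphic_on S" "l m holomorphic_on S" if "m \<in> I" for m
      using \<alpha>[OF that] l[OF that] by (auto intro: holomorphic_on_subset)
    show "dominates I \<alpha> l i a" "dominates I \<alpha> l j b" using a b by (auto simp: R_def)
  qed fact+
  then obtain n w where n: "n > 0" "w \<in> S" "(\<Sum>j\<in>I. \<alpha> j w * l j w ^ n) = 0" by blast
  have "w \<noteq> z" "dist w z < e"
    using n d by (auto simp: S_def dist_commute)
  then show "\<exists>x'\<in>\<Union>n\<in>{1..}. {w. (\<Sum>j\<in>I. \<alpha> j w * l j w ^ n) = 0}. x' \<noteq> z \<and> dist x' z < e"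
    using n by (intro bexI[of _ w]) (auto simp: Suc_le_eq)
qed

text \<open>The strict inequalities between the bases persist near \<open>z\<close> with fixed
  ratios below 1. The remaining terms are then small against the dominant one for all large n, with
  one threshold for the whole neighbourhood.\<close>

lemma power_sum_no_zeros_near:
  assumes fin: "finite I" and dom: "dominates I \<alpha> l i z"
    and \<alpha>: "\<And>j. j \<in> I \<Longrightarrow> isCont (\<alpha> j) z" and l: "\<And>j. j \<in> I \<Longrightarrow> isCont (l j) z"
  shows "\<exists>N. \<forall>\<^sub>F w in nhds z. \<forall>n\<ge>N. (\<Sum>j\<in>I. \<alpha> j w * l j w ^ n) \<noteq> 0"
proof -
  have iI: "i \<in> I" and nz: "\<alpha> i z \<noteq> 0" "l i z \<noteq> 0" using dom by (auto simp: dominates_def)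
  have ratio: "\<exists>q. 0 \<le> q \<and> q < 1 \<and> cmod (l j z) < q * cmod (l i z)" if "j \<in> I - {i}" for j
  proof -
    have "cmod (l j z) / cmod (l i z) < 1" 
      using dom that by (auto simp: dominates_def divide_simps)
    then obtain q where "cmod (l j z) / cmod (l i z) < q" "q < 1" using dense by blast
    moreover from this have "0 \<le> q" by (smt (verit) divide_nonneg_nonneg norm_ge_zero)
    ultimately show ?thesis using nz by (auto simp: divide_simps)
  qed
  then obtain q where q: "\<And>j. j \<in> I - {i} \<Longrightarrow> 0 \<le> q j \<and> q j < 1 \<and> cmod (l j z) < q j * cmod (l i z)"
    by metis
  \<comment> \<open>Half the modulus at \<open>z\<close> is a lower bound for the dominant
    coefficient at all nearby points.\<close>
  define \<delta> where "\<delta> = cmod (\<alpha> i z) / 2"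
  have \<delta>: "0 < \<delta>" "\<delta> < cmod (\<alpha> i z)" using nz by (auto simp: \<delta>_def)
  \<comment> \<open>This majorant of the other terms, relative to the dominant power, does not
    depend on w; so neither does \<open>N\<close>.\<close>
  have "(\<lambda>n. \<Sum>j\<in>I - {i}. (cmod (\<alpha> j z) + 1) * q j ^ n) \<longlonglongrightarrow> (\<Sum>j\<in>I - {i}. (cmod (\<alpha> j z) + 1) * 0)"
    using q by (intro tendsto_intros LIMSEQ_power_zero) auto
  then have "\<forall>\<^sub>F n in sequentially. (\<Sum>j\<in>I - {i}. (cmod (\<alpha> j z) + 1) * q j ^ n) < \<delta>"
    using \<delta> by (intro order_tendstoD(2)) auto
  then obtain N where N: "\<And>n. n \<ge> N \<Longrightarrow> (\<Sum>j\<in>I - {i}. (cmod (\<alpha> j z) + 1) * q j ^ n) < \<delta>"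
    by (auto simp: eventually_sequentially)
  have "\<forall>\<^sub>F w in nhds z. \<delta> < cmod (\<alpha> i w)"
    using \<alpha>[OF iI] \<delta> by (intro order_tendstoD(1)[OF tendsto_norm]) (auto simp: isCont_def tendsto_at_iff_tendsto_nhds)
  moreover have "\<forall>\<^sub>F w in nhds z. l i w \<noteq> 0"
    using l[OF iI] nz(2) unfolding isCont_def tendsto_at_iff_tendsto_nhds by (rule tendsto_imp_eventually_ne)
  moreover have "\<forall>\<^sub>F w in nhds z. \<forall>j\<in>I - {i}. cmod (\<alpha> j w) < cmod (\<alpha> j z) + 1 \<and> cmod (l j w) < q j * cmod (l i w)"
  proof (intro eventually_ball_finite ballI eventually_conj)
    fix j assume j: "j \<in> I - {i}"
    then have c: "(\<alpha> j \<longlongrightarrow> \<alpha> j z) (nhds z)" "(l j \<longlongrightarrow> l j z) (nhds z)" "(l i \<longlongrightarrow> l i z) (nhds z)"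
      using \<alpha> l iI by (auto simp: isCont_def tendsto_at_iff_tendsto_nhds)
    show "\<forall>\<^sub>F w in nhds z. cmod (\<alpha> j w) < cmod (\<alpha> j z) + 1"
      by (rule order_tendstoD(2)[OF tendsto_norm[OF c(1)]]) simp
    have "((\<lambda>w. q j * cmod (l i w) - cmod (l j w)) \<longlongrightarrow> q j * cmod (l i z) - cmod (l j z)) (nhds z)"
      by (intro tendsto_intros c)
    then have "\<forall>\<^sub>F w in nhds z. 0 < q j * cmod (l i w) - cmod (l j w)"
      using q[OF j] by (intro order_tendstoD(1)) auto
    then show "\<forall>\<^sub>F w in nhds z. cmod (l j w) < q j * cmod (l i w)" by simp
  qed (use fin in auto)
  ultimately have "\<forall>\<^sub>F w in nhds z. \<forall>n\<ge>N. (\<Sum>j\<in>I. \<alpha> j w * l j w ^ n) \<noteq> 0"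
  proof eventually_elim
    case (elim w)
    show ?case
    proof (intro allI impI notI)
      fix n assume n: "n \<ge> N" and "(\<Sum>j\<in>I. \<alpha> j w * l j w ^ n) = 0"
      then have "\<alpha> i w * l i w ^ n = - (\<Sum>j\<in>I - {i}. \<alpha> j w * l j w ^ n)"
        using fin iI by (simp add: sum.remove[of I i] eq_neg_iff_add_eq_0)
      then have "cmod (\<alpha> i w) * cmod (l i w) ^ n = cmod (\<Sum>j\<in>I - {i}. \<alpha> j w * l j w ^ n)"
        by (metis norm_minus_cancel norm_mult norm_power)
      also have "\<dots> \<le> (\<Sum>j\<in>I - {i}. (cmod (\<alpha> j z) + 1) * (q j * cmod (l i w)) ^ n)"
        using elim q by (intro sum_norm_le)
          (auto simp: norm_mult norm_power intro!: mult_mono power_mono intro: less_imp_le)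
      also have "\<dots> = (\<Sum>j\<in>I - {i}. (cmod (\<alpha> j z) + 1) * q j ^ n) * cmod (l i w) ^ n"
        by (simp add: sum_distrib_right power_mult_distrib mult.assoc)
      also have "\<dots> < \<delta> * cmod (l i w) ^ n"
        using N[OF n] elim by (intro mult_strict_right_mono) auto
      also have "\<dots> < cmod (\<alpha> i w) * cmod (l i w) ^ n"
        using elim by (intro mult_strict_right_mono) auto
      finally show False .
    qed
  qed
  then show ?thesis by blast
qed

subsection \<open>The domination polynomial of the book graph\<close>

lemma sum_Pow_insert:
  assumes "finite A" "a \<notin> A"
  shows "(\<Sum>T\<in>Pow (insert a A). g T) = (\<Sum>T\<in>Pow A. g T) + (\<Sum>T\<in>Pow A. g (insert a T))"
proof -
  have "inj_on (insert a) (Pow A)"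
    using assms(2) by (auto simp: inj_on_def)
  moreover have "Pow A \<inter> insert a ` Pow A = {}"
    using assms(2) by auto
  ultimately show ?thesis
    using assms(1) by (simp add: Pow_insert sum.union_disjoint sum.reindex)
qed

text \<open>Dominating sets are regrouped by cardinality; every such cardinality lies between the
  domination number and the order of the graph.\<close>

lemma poly_domination_poly:
  assumes "finite (verts G)"
  shows "poly (domination_poly G) x = (\<Sum>S\<in>Pow (verts G). if dominating G S then x ^ card S else 0)"
proof -
  let ?D = "{S. dominating G S}"
  have sub: "?D \<subseteq> Pow (verts G)" by (auto simp: dominating_def)
  then have fin: "finite ?D" using assms finite_subset by blast
  have range: "card S \<in> {domination_number G..card (verts G)}" if "S \<in> ?D" for S
    using that fin sub assms by (auto simp: domination_number_def card_mono intro: Min_le)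
  have "(\<Sum>S\<in>Pow (verts G). if dominating G S then x ^ card S else 0) = (\<Sum>S\<in>?D. x ^ card S)"
    using assms sub by (intro sum.mono_neutral_cong_right) auto
  also have "\<dots> = (\<Sum>i = domination_number G..card (verts G). \<Sum>S | S \<in> ?D \<and> card S = i. x ^ card S)"
    using range by (intro sum.group[symmetric] fin) auto
  also have "\<dots> = poly (domination_poly G) x"
    by (simp add: domination_poly_def poly_sum poly_monom num_dominating_def)
  finally show ?thesis ..
qed

definition pages :: "nat \<Rightarrow> book_vertex set" where
  "pages n = (\<Union>i\<in>{1..n}. {V i, W i})"

lemma finite_pages [simp]: "finite (pages n)"
  by (simp add: pages_def)

lemma mem_pages [simp]:
  "U k \<notin> pages n" "V i \<in> pages n \<longleftrightarrow> i \<in> {1..n}" "W i \<in> pages n \<longleftrightarrow> i \<in> {1..n}"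
  by (auto simp: pages_def)

lemma ball_pages:
  "(\<forall>x\<in>pages n. P x) \<longleftrightarrow> (\<forall>i\<in>{1..n}. P (V i)) \<and> (\<forall>i\<in>{1..n}. P (W i))"
  by (auto simp: pages_def)

text \<open>The condition \<open>Q\<close> constrains each page separately, so the generating sum is
  a product over pages. Each factor lists the four possible traces on a page with their
  weights.\<close>

lemma sum_pages:
  fixes x :: complex
  shows "(\<Sum>T\<in>Pow (pages n). if \<forall>i\<in>{1..n}. Q (V i \<in> T) (W i \<in> T) then x ^ card T else 0) =
    ((if Q False False then 1 else 0) + (if Q True False then x else 0) +
     (if Q False True then x else 0) + (if Q True True then x ^ 2 else 0)) ^ n"
    (is "?L n = ?c ^ n")
proof (induction n)
  case 0
  then show ?case by (simp add: pages_def)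
next
  case (Suc n)
  let ?v = "V (Suc n)" and ?w = "W (Suc n)"
  let ?P = "\<lambda>T. \<forall>i\<in>{1..n}. Q (V i \<in> T) (W i \<in> T)"
  have pages: "pages (Suc n) = insert ?v (insert ?w (pages n))"
    by (auto simp: pages_def atLeastAtMostSuc_conv)
  have eq: "(\<forall>i\<in>{1..Suc n}. Q (V i \<in> T) (W i \<in> T)) \<longleftrightarrow> Q (?v \<in> T) (?w \<in> T) \<and> ?P T" for T
    by (auto simp: atLeastAtMostSuc_conv)
  have T: "?v \<notin> T" "?w \<notin> T" "finite T" if "T \<in> Pow (pages n)" for T
    using that finite_subset[OF _ finite_pages] by auto
  let ?g = "\<lambda>T. if Q (?v \<in> T) (?w \<in> T) \<and> ?P T then x ^ card T else 0"
  have "?L (Suc n) = (\<Sum>T\<in>Pow (insert ?v (insert ?w (pages n))). ?g T)"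
    unfolding pages eq ..
  \<comment> \<open>The subsets are split by their trace on the last page.\<close>
  also have "\<dots> = (\<Sum>T\<in>Pow (pages n). ?g T + ?g (insert ?w T) + (?g (insert ?v T) + ?g (insert ?v (insert ?w T))))"
    by (subst sum_Pow_insert, simp, simp)+ (simp only: sum.distrib)
  also have "\<dots> = (\<Sum>T\<in>Pow (pages n). ?c * (if ?P T then x ^ card T else 0))"
  proof (intro sum.cong refl)
    fix T assume "T \<in> Pow (pages n)"
    note [simp] = T[OF this]
    define p where "p = ?P T"
    have *: "?P (insert ?v T) = ?P T" "?P (insert ?w T) = ?P T" "?P (insert ?v (insert ?w T)) = ?P T"
      by auto
    show "?g T + ?g (insert ?w T) + (?g (insert ?v T) + ?g (insert ?v (insert ?w T))) =
        ?c * (if ?P T then x ^ card T else 0)"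
      unfolding * p_def[symmetric] by (cases p) (simp_all add: power2_eq_square algebra_simps)
  qed
  finally show ?case
    using Suc.IH by (simp add: sum_distrib_left[symmetric])
qed

text \<open>Each class of vertices is tested against its closed neighbourhood. Once the trace on the
  path is fixed, only conditions on the pages remain.\<close>

lemma dominating_book5_iff:
  assumes "S \<subseteq> {U 1, U 2, U 3} \<union> pages n"
  shows "dominating (book5 n) S \<longleftrightarrow>
    (U 1 \<in> S \<or> U 2 \<in> S \<or> (\<exists>i\<in>{1..n}. V i \<in> S)) \<and>
    (U 1 \<in> S \<or> U 2 \<in> S \<or> U 3 \<in> S) \<and>
    (U 3 \<in> S \<or> U 2 \<in> S \<or> (\<exists>i\<in>{1..n}. W i \<in> S)) \<and>
    (\<forall>i\<in>{1..n}. V i \<in> S \<or> W i \<in> S \<or> U 1 \<in> S) \<and>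
    (\<forall>i\<in>{1..n}. V i \<in> S \<or> W i \<in> S \<or> U 3 \<in> S)"
proof -
  have v: "verts (book5 n) = {U 1, U 2, U 3} \<union> pages n"
    by (simp add: book5_def pages_def)
  have adj: "adjacent (book5 n) (U 1) y \<longleftrightarrow> y = U 2 \<or> (\<exists>i\<in>{1..n}. y = V i)"
    "adjacent (book5 n) (U 2) y \<longleftrightarrow> y = U 1 \<or> y = U 3"
    "adjacent (book5 n) (U 3) y \<longleftrightarrow> y = U 2 \<or> (\<exists>i\<in>{1..n}. y = W i)"
    "adjacent (book5 n) (V i) y \<longleftrightarrow> i \<in> {1..n} \<and> (y = U 1 \<or> y = W i)"
    "adjacent (book5 n) (W i) y \<longleftrightarrow> i \<in> {1..n} \<and> (y = U 3 \<or> y = V i)" for y i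
    by (auto simp: adjacent_def book5_def doubleton_eq_iff)
  let ?d = "\<lambda>x. x \<in> S \<or> (\<exists>y\<in>S. adjacent (book5 n) x y)"
  have "dominating (book5 n) S \<longleftrightarrow> (\<forall>x\<in>{U 1, U 2, U 3} \<union> pages n. ?d x)"
    using assms unfolding v[symmetric] dominating_def by blast
  also have "\<dots> \<longleftrightarrow> ?d (U 1) \<and> ?d (U 2) \<and> ?d (U 3) \<and> (\<forall>i\<in>{1..n}. ?d (V i)) \<and> (\<forall>i\<in>{1..n}. ?d (W i))"
    by (simp only: ball_Un ball_pages ball_simps simp_thms conj_assoc)
  also have "?d (U 1) \<longleftrightarrow> U 1 \<in> S \<or> U 2 \<in> S \<or> (\<exists>i\<in>{1..n}. V i \<in> S)"
    unfolding adj by blast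
  also have "?d (U 2) \<longleftrightarrow> U 1 \<in> S \<or> U 2 \<in> S \<or> U 3 \<in> S"
    unfolding adj by blast
  also have "?d (U 3) \<longleftrightarrow> U 3 \<in> S \<or> U 2 \<in> S \<or> (\<exists>i\<in>{1..n}. W i \<in> S)"
    unfolding adj by blast
  also have "(\<forall>i\<in>{1..n}. ?d (V i)) \<longleftrightarrow> (\<forall>i\<in>{1..n}. V i \<in> S \<or> W i \<in> S \<or> U 1 \<in> S)"
    unfolding adj by (intro ball_cong refl) blast
  also have "(\<forall>i\<in>{1..n}. ?d (W i)) \<longleftrightarrow> (\<forall>i\<in>{1..n}. V i \<in> S \<or> W i \<in> S \<or> U 3 \<in> S)"
    unfolding adj by (intro ball_cong refl) blast
  finally show ?thesis .
qed

text \<open>The bases are page factors: (1+x)^2 for an unconstrained page, x(x+2) for a page that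
  must be met, and x for a page with one prescribed vertex.\<close>

lemma poly_domination_poly_book5:
  "poly (domination_poly (book5 n)) x =
     x\<^sup>2 * (1 + x) * ((1 + x)\<^sup>2) ^ n + x * (2 * x + 3) * (x * (x + 2)) ^ n - 2 * x * x ^ n"
proof -
  have v: "verts (book5 n) = insert (U 1) (insert (U 2) (insert (U 3) (pages n)))"
    by (auto simp: book5_def pages_def)
  have fin: "finite (verts (book5 n))" by (simp add: v)
  have T: "finite T" "U k \<notin> T" if "T \<in> Pow (pages n)" for T k
    using that finite_subset[OF _ finite_pages] by auto
  define J where "J = {1..n}"
  define c where "c = (\<lambda>Q T. if \<forall>i\<in>J. Q (V i \<in> T) (W i \<in> T) then x ^ card T else 0)"
  have c_sum: "(\<Sum>T\<in>Pow (pages n). c Q T) =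
      ((if Q False False then 1 else 0) + (if Q True False then x else 0) +
       (if Q False True then x else 0) + (if Q True True then x ^ 2 else 0)) ^ n" for Q
    unfolding c_def J_def by (rule sum_pages)
  let ?D = "\<lambda>S. if dominating (book5 n) S then x ^ card S else 0"
  \<comment> \<open>One equation for each of the eight traces on the path; the empty trace leaves
    \<open>U 2\<close> undominated.\<close>
  have D: "?D T = 0"
    "?D (insert (U 1) T) = x * (c (\<lambda>v w. v \<or> w) T - c (\<lambda>v w. v \<and> \<not> w) T)"
    "?D (insert (U 2) T) = x * c (\<lambda>v w. v \<or> w) T"
    "?D (insert (U 3) T) = x * (c (\<lambda>v w. v \<or> w) T - c (\<lambda>v w. \<not> v \<and> w) T)"
    "?D (insert (U 1) (insert (U 2) T)) = x\<^sup>2 * c (\<lambda>v w. v \<or> w) T"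
    "?D (insert (U 2) (insert (U 3) T)) = x\<^sup>2 * c (\<lambda>v w. v \<or> w) T"
    "?D (insert (U 1) (insert (U 3) T)) = x\<^sup>2 * c (\<lambda>v w. True) T"
    "?D (insert (U 1) (insert (U 2) (insert (U 3) T))) = x ^ 3 * c (\<lambda>v w. True) T"
    if "T \<in> Pow (pages n)" for T
  proof -
    have d: "dominating (book5 n) (H \<union> T) \<longleftrightarrow>
        (U 1 \<in> H \<or> U 2 \<in> H \<or> (\<exists>i\<in>J. V i \<in> T)) \<and>
        (U 1 \<in> H \<or> U 2 \<in> H \<or> U 3 \<in> H) \<and>
        (U 3 \<in> H \<or> U 2 \<in> H \<or> (\<exists>i\<in>J. W i \<in> T)) \<and>
        (\<forall>i\<in>J. V i \<in> T \<or> W i \<in> T \<or> U 1 \<in> H) \<and>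
        (\<forall>i\<in>J. V i \<in> T \<or> W i \<in> T \<or> U 3 \<in> H)"
      if H: "H \<subseteq> {U 1, U 2, U 3}" for H
    proof -
      have "H \<union> T \<subseteq> {U 1, U 2, U 3} \<union> pages n"
        using H \<open>T \<in> Pow (pages n)\<close> by blast
      moreover have "U k \<in> H \<union> T \<longleftrightarrow> U k \<in> H" "V i \<in> H \<union> T \<longleftrightarrow> V i \<in> T"
        "W i \<in> H \<union> T \<longleftrightarrow> W i \<in> T" for k i
        using H T[OF \<open>T \<in> Pow (pages n)\<close>] by auto
      ultimately show ?thesis by (simp only: dominating_book5_iff J_def)
    qed
    note [simp] = T[OF that] c_def and [simp del] = One_nat_def
    show "?D T = 0" using d[of "{}"] by simp
    \<comment> \<open>Here \<open>U 3\<close> needs some \<open>W i\<close>. Among the sets meeting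
      every page, exactly the set of all \<open>V i\<close> fails this, which accounts for the
      subtracted term; the trace \<open>U 3\<close> is symmetric.\<close>
    have "dominating (book5 n) (insert (U 1) T) \<longleftrightarrow>
        (\<exists>i\<in>J. W i \<in> T) \<and> (\<forall>i\<in>J. V i \<in> T \<or> W i \<in> T)"
      using d[of "{U 1}"] by simp
    then show "?D (insert (U 1) T) = x * (c (\<lambda>v w. v \<or> w) T - c (\<lambda>v w. v \<and> \<not> w) T)"
      by auto
    show "?D (insert (U 2) T) = x * c (\<lambda>v w. v \<or> w) T"
      using d[of "{U 2}"] by auto
    have "dominating (book5 n) (insert (U 3) T) \<longleftrightarrow>
        (\<exists>i\<in>J. V i \<in> T) \<and> (\<forall>i\<in>J. V i \<in> T \<or> W i \<in> T)"
      using d[of "{U 3}"] by simp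
    then show "?D (insert (U 3) T) = x * (c (\<lambda>v w. v \<or> w) T - c (\<lambda>v w. \<not> v \<and> w) T)"
      by auto
    show "?D (insert (U 1) (insert (U 2) T)) = x\<^sup>2 * c (\<lambda>v w. v \<or> w) T"
      using d[of "{U 1, U 2}"] by (auto simp: power2_eq_square)
    show "?D (insert (U 2) (insert (U 3) T)) = x\<^sup>2 * c (\<lambda>v w. v \<or> w) T"
      using d[of "{U 2, U 3}"] by (auto simp: power2_eq_square)
    show "?D (insert (U 1) (insert (U 3) T)) = x\<^sup>2 * c (\<lambda>v w. True) T"
      using d[of "{U 1, U 3}"] by (auto simp: power2_eq_square)
    show "?D (insert (U 1) (insert (U 2) (insert (U 3) T))) = x ^ 3 * c (\<lambda>v w. True) T"
      using d[of "{U 1, U 2, U 3}"] by (auto simp: power3_eq_cube)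
  qed
  have "(\<Sum>S\<in>Pow (verts (book5 n)). ?D S) =
     (\<Sum>T\<in>Pow (pages n). ?D T + ?D (insert (U 3) T) + (?D (insert (U 2) T) + ?D (insert (U 2) (insert (U 3) T))) +
       (?D (insert (U 1) T) + ?D (insert (U 1) (insert (U 3) T)) +
        (?D (insert (U 1) (insert (U 2) T)) + ?D (insert (U 1) (insert (U 2) (insert (U 3) T))))))"
    unfolding v by (simp add: sum_Pow_insert sum.distrib del: One_nat_def)
  also have "\<dots> =
     (\<Sum>T\<in>Pow (pages n). x * c (\<lambda>v w. v \<or> w) T
         + 2 * (x * (c (\<lambda>v w. v \<or> w) T) + x ^ 2 * c (\<lambda>v w. v \<or> w) T)
         - x * c (\<lambda>v w. v \<and> \<not> w) T - x * c (\<lambda>v w. \<not> v \<and> w) T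
         + (x ^ 2 + x ^ 3) * c (\<lambda>v w. True) T)"
    by (intro sum.cong refl) (simp only: D, simp add: algebra_simps)
  also have "\<dots> = x * (x + x + x ^ 2) ^ n
         + 2 * (x * (x + x + x ^ 2) ^ n + x ^ 2 * (x + x + x ^ 2) ^ n)
         - x * x ^ n - x * x ^ n
         + (x ^ 2 + x ^ 3) * (1 + x + x + x ^ 2) ^ n"
    by (simp add: sum.distrib sum_subtractf sum_distrib_left[symmetric] c_sum)
  also have "x + x + x ^ 2 = x * (x + 2)"
    by (simp add: algebra_simps power2_eq_square)
  also have "1 + x + x + x ^ 2 = (1 + x) ^ 2"
    by (simp add: algebra_simps power2_eq_square)
  finally show ?thesis
    unfolding poly_domination_poly[OF fin]
    by (simp add: algebra_simps power2_eq_square power3_eq_cube)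
qed

text \<open>Near \<open>z\<close> there are no zeros of index at least some N, and the finitely many
  earlier polynomials, being nonzero, have finitely many zeros in total, which cannot
  accumulate.\<close>

lemma not_limit_of_roots_if_dominates:
  fixes f :: "nat \<Rightarrow> complex poly"
  assumes fin: "finite I" and dom: "dominates I \<alpha> l i z"
    and \<alpha>: "\<And>j. j \<in> I \<Longrightarrow> isCont (\<alpha> j) z" and l: "\<And>j. j \<in> I \<Longrightarrow> isCont (l j) z"
    and f: "\<And>n w. poly (f n) w = (\<Sum>j\<in>I. \<alpha> j w * l j w ^ n)" and nz: "\<And>n. f n \<noteq> 0"
  shows "\<not> limit_of_roots f z"
proof -
  obtain N where N: "\<forall>\<^sub>F w in nhds z. \<forall>n\<ge>N. poly (f n) w \<noteq> 0"
    using power_sum_no_zeros_near[OF fin dom \<alpha> l] f by auto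
  have "\<not> (\<exists>M. \<forall>n\<ge>M. poly (f n) z = 0)"
  proof
    assume "\<exists>M. \<forall>n\<ge>M. poly (f n) z = 0"
    then obtain M where "\<forall>n\<ge>M. poly (f n) z = 0" ..
    then have "poly (f (max M N)) z = 0" by simp
    then show False using eventually_nhds_x_imp_x[OF N] by simp
  qed
  moreover have "\<not> z islimpt (\<Union>n\<in>{1..}. {w. poly (f n) w = 0})"
  proof
    assume "z islimpt (\<Union>n\<in>{1..}. {w. poly (f n) w = 0})"
    moreover have "(\<Union>n\<in>{1..}. {w. poly (f n) w = 0}) \<subseteq>
        (\<Union>n\<in>{..<N}. {w. poly (f n) w = 0}) \<union> (\<Union>n\<in>{N..}. {w. poly (f n) w = 0})"
      by (force simp: not_le[symmetric])
    moreover have "finite (\<Union>n\<in>{..<N}. {w. poly (f n) w = 0})"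
      using nz by (simp add: poly_roots_finite)
    ultimately have "z islimpt (\<Union>n\<in>{N..}. {w. poly (f n) w = 0})"
      by (meson islimpt_Un_finite islimpt_subset)
    moreover obtain T where "open T" "z \<in> T" "\<And>w n. w \<in> T \<Longrightarrow> n \<ge> N \<Longrightarrow> poly (f n) w \<noteq> 0"
      using N unfolding eventually_nhds by blast
    ultimately show False unfolding islimpt_def by blast
  qed
  ultimately show ?thesis by (simp add: limit_of_roots_def)
qed

section \<open>The three bases of the book graph and their dominance regions\<close>

definition book_coeff :: "nat \<Rightarrow> complex \<Rightarrow> complex" where
  "book_coeff i z = (if i = 0 then z\<^sup>2 * (1 + z) else if i = 1 then z * (2 * z + 3) else - 2 * z)"

definition book_base :: "nat \<Rightarrow> complex \<Rightarrow> complex" where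
  "book_base i z = (if i = 0 then (1 + z)\<^sup>2 else if i = 1 then z * (z + 2) else z)"

abbreviation book_dominates :: "nat \<Rightarrow> complex \<Rightarrow> bool" where
  "book_dominates \<equiv> dominates {0, 1, 2} book_coeff book_base"

lemma poly_book5_eq_power_sum:
  "poly (domination_poly (book5 n)) z = (\<Sum>i\<in>{0, 1, 2}. book_coeff i z * book_base i z ^ n)"
  by (simp add: poly_domination_poly_book5 book_coeff_def book_base_def)

lemma domination_poly_book5_nonzero: "domination_poly (book5 n) \<noteq> 0"
proof
  assume "domination_poly (book5 n) = 0"
  \<comment> \<open>The value at 1, which is the number of dominating sets, is positive.\<close>
  then have "complex_of_real (2 * 4 ^ n + 5 * 3 ^ n - 2) = 0"
    using poly_domination_poly_book5[of n 1] by simp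
  then have "2 * 4 ^ n + 5 * 3 ^ n - 2 = (0::real)"
    using of_real_eq_0_iff by blast
  moreover have "(1::real) \<le> 4 ^ n" "(1::real) \<le> 3 ^ n" by simp_all
  ultimately show False by linarith
qed

lemma book_holomorphic: "book_coeff i holomorphic_on S" "book_base i holomorphic_on S"
  unfolding book_coeff_def[abs_def] book_base_def[abs_def]
  by (cases "i = 0"; cases "i = 1"; simp; intro holomorphic_intros)+

lemma book_isCont: "isCont (book_coeff i) z" "isCont (book_base i) z"
  using book_holomorphic[of i UNIV, THEN holomorphic_on_imp_continuous_on]
  by (auto simp: continuous_on_eq_continuous_at)

lemma book_dominates_0:
  assumes "z \<noteq> 0" "cmod z * cmod (z + 2) < (cmod (z + 1))\<^sup>2" "cmod z < (cmod (z + 1))\<^sup>2"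
  shows "book_dominates 0 z"
proof -
  have "1 + z \<noteq> 0" using assms(3) by (auto simp: add.commute)
  then show ?thesis
    using assms by (auto simp: dominates_def book_coeff_def book_base_def norm_mult norm_power add.commute)
qed

text \<open>Bases 1 and 2 have quotient z + 2, so |z + 2| against 1 decides between them.\<close>

lemma book_dominates_1:
  assumes "z \<noteq> 0" "(cmod (z + 1))\<^sup>2 < cmod z * cmod (z + 2)" "1 < cmod (z + 2)"
  shows "book_dominates 1 z"
proof -
  \<comment> \<open>The zero -3/2 of the coefficient has |z + 2| = 1/2.\<close>
  have "2 * z + 3 \<noteq> 0"
  proof
    assume "2 * z + 3 = 0"
    then have "z = - 3 / 2" by (simp add: field_simps eq_neg_iff_add_eq_0)
    then show False using assms(3) by simp
  qed
  moreover have "z + 2 \<noteq> 0" using assms(3) by auto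
  moreover have "cmod z < cmod z * cmod (z + 2)" using assms by simp
  ultimately show ?thesis
    using assms by (auto simp: dominates_def book_coeff_def book_base_def norm_mult norm_power add.commute)
qed

lemma book_dominates_2:
  assumes "(cmod (z + 1))\<^sup>2 < cmod z" "cmod (z + 2) < 1"
  shows "book_dominates 2 z"
proof -
  have "z \<noteq> 0" using assms(1) by auto
  moreover from this have "cmod z * cmod (z + 2) < cmod z" using assms by simp
  ultimately show ?thesis
    using assms by (auto simp: dominates_def book_coeff_def book_base_def norm_mult norm_power add.commute)
qed

lemma not_limit_of_roots_book5:
  assumes "book_dominates i z"
  shows "\<not> limit_of_roots (\<lambda>n. domination_poly (book5 n)) z"
proof (rule not_limit_of_roots_if_dominates)
  show "book_dominates i z" by fact
  show "poly (domination_poly (book5 n)) w = (\<Sum>j\<in>{0, 1, 2}. book_coeff j w * book_base j w ^ n)" for n w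
    by (rule poly_book5_eq_power_sum)
  show "domination_poly (book5 n) \<noteq> 0" for n by (rule domination_poly_book5_nonzero)
  show "isCont (book_coeff j) z" "isCont (book_base j) z" for j by (rule book_isCont)+
qed simp

abbreviation book_roots :: "complex set" where
  "book_roots \<equiv> \<Union>n\<in>{1..}. {w. poly (domination_poly (book5 n)) w = 0}"

lemma islimpt_book_roots:
  assumes "\<And>e. e > 0 \<Longrightarrow> \<exists>i j a b. i \<noteq> j \<and> dist a z < e \<and> book_dominates i a \<and>
        dist b z < e \<and> book_dominates j b"
  shows "z islimpt book_roots"
  unfolding poly_book5_eq_power_sum
  by (rule islimpt_power_sum_zeros[OF _ book_holomorphic assms]) simp

subsection \<open>The equimodular curves\<close>

lemmas cmod_squares = cmod_power2 plus_complex.sel one_complex.sel complex_Re_numeral complex_Im_numeral add_0_right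

lemma less_iff_sq_less: "0 \<le> a \<Longrightarrow> 0 \<le> b \<Longrightarrow> a < b \<longleftrightarrow> a\<^sup>2 < (b::real)\<^sup>2"
  by (metis linorder_not_le pos2 power_mono_iff)

text \<open>With w = z + 1 the bases are w^2 - 1 and w^2, and |w^2 - 1|^2 - |w^2|^2 = 1 - 2 Re(w^2).
  Equal moduli thus mean Re(w^2) = 1/2, the hyperbola.\<close>

lemma base01_diff:
  "(cmod z * cmod (z + 2))\<^sup>2 - ((cmod (z + 1))\<^sup>2)\<^sup>2 = 1 - 2 * ((Re z + 1)\<^sup>2 - (Im z)\<^sup>2)"
  unfolding power_mult_distrib cmod_squares by algebra

lemma base01_less_iff:
  "(cmod (z + 1))\<^sup>2 < cmod z * cmod (z + 2) \<longleftrightarrow> (Re z + 1)\<^sup>2 - (Im z)\<^sup>2 < 1 / 2"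
  "cmod z * cmod (z + 2) < (cmod (z + 1))\<^sup>2 \<longleftrightarrow> 1 / 2 < (Re z + 1)\<^sup>2 - (Im z)\<^sup>2"
proof -
  have "(cmod (z + 1))\<^sup>2 < cmod z * cmod (z + 2) \<longleftrightarrow> ((cmod (z + 1))\<^sup>2)\<^sup>2 < (cmod z * cmod (z + 2))\<^sup>2"
    by (rule less_iff_sq_less) auto
  then show "(cmod (z + 1))\<^sup>2 < cmod z * cmod (z + 2) \<longleftrightarrow> (Re z + 1)\<^sup>2 - (Im z)\<^sup>2 < 1 / 2"
    using base01_diff[of z] by (smt (verit) field_sum_of_halves)
  have "cmod z * cmod (z + 2) < (cmod (z + 1))\<^sup>2 \<longleftrightarrow> (cmod z * cmod (z + 2))\<^sup>2 < ((cmod (z + 1))\<^sup>2)\<^sup>2"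
    by (rule less_iff_sq_less) auto
  then show "cmod z * cmod (z + 2) < (cmod (z + 1))\<^sup>2 \<longleftrightarrow> 1 / 2 < (Re z + 1)\<^sup>2 - (Im z)\<^sup>2"
    using base01_diff[of z] by (smt (verit) field_sum_of_halves)
qed

lemma sq_less_2_iff: "(x::real)\<^sup>2 < 2 \<longleftrightarrow> \<bar>x\<bar> < sqrt 2"
  using real_sqrt_less_iff[of "x\<^sup>2" 2] by simp

lemma sq_greater_2_iff: "2 < (x::real)\<^sup>2 \<longleftrightarrow> sqrt 2 < \<bar>x\<bar>"
  using real_sqrt_less_iff[of 2 "x\<^sup>2"] by simp

lemma sqrt2_bounds: "1 < sqrt 2" "sqrt 2 < 3 / 2"
proof -
  show "sqrt 2 < 3 / 2" by (rule real_less_lsqrt) (auto simp: power2_eq_square)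
qed simp

text \<open>On the circle the comparison of bases 0 and 2 reduces to that of (2 Re z + 3)^2 with
  2.\<close>

lemma circle_less_iff:
  assumes "cmod (z + 2) = 1"
  shows "(cmod (z + 1))\<^sup>2 < cmod z \<longleftrightarrow> - 3 / 2 - sqrt 2 / 2 < Re z"
    "cmod z < (cmod (z + 1))\<^sup>2 \<longleftrightarrow> Re z < - 3 / 2 - sqrt 2 / 2"
proof -
  have one: "(Re z + 2)\<^sup>2 + (Im z)\<^sup>2 = 1"
    using assms cmod_power2[of "z + 2"] by simp
  then have "(Re z + 2)\<^sup>2 \<le> 1\<^sup>2" by (smt (verit) zero_le_power2 one_power2)
  then have "\<bar>Re z + 2\<bar> \<le> 1" by (simp add: abs_le_square_iff[of _ 1, simplified])
  \<comment> \<open>In this range 2 Re z + 3 is at most 1, so only the threshold -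
    \<open>sqrt 2\<close> can be crossed.\<close>
  then have bounds: "Re z \<le> -1" "-3 \<le> Re z" by linarith+
  have diff: "(cmod z)\<^sup>2 - ((cmod (z + 1))\<^sup>2)\<^sup>2 = 2 - (2 * Re z + 3)\<^sup>2"
    unfolding cmod_squares using one by algebra
  have "(cmod (z + 1))\<^sup>2 < cmod z \<longleftrightarrow> ((cmod (z + 1))\<^sup>2)\<^sup>2 < (cmod z)\<^sup>2"
    by (rule less_iff_sq_less) auto
  also have "\<dots> \<longleftrightarrow> \<bar>2 * Re z + 3\<bar> < sqrt 2"
    using diff sq_less_2_iff[of "2 * Re z + 3"] by linarith
  finally show "(cmod (z + 1))\<^sup>2 < cmod z \<longleftrightarrow> - 3 / 2 - sqrt 2 / 2 < Re z"
    using bounds sqrt2_bounds by linarith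
  have "cmod z < (cmod (z + 1))\<^sup>2 \<longleftrightarrow> (cmod z)\<^sup>2 < ((cmod (z + 1))\<^sup>2)\<^sup>2"
    by (rule less_iff_sq_less) auto
  also have "\<dots> \<longleftrightarrow> sqrt 2 < \<bar>2 * Re z + 3\<bar>"
    using diff sq_greater_2_iff[of "2 * Re z + 3"] by linarith
  finally show "cmod z < (cmod (z + 1))\<^sup>2 \<longleftrightarrow> Re z < - 3 / 2 - sqrt 2 / 2"
    using bounds sqrt2_bounds by linarith
qed

text \<open>On the hyperbola |z + 2| > 1 becomes |2 (Re z + 1) + 1| > \<open>sqrt 2\<close>. This
  always holds on the right branch. On the left branch it fails exactly from the crossing with the
  circle up to the vertex, the two ends of the interval.\<close>

lemma hyperbola_greater_iff:
  assumes "(Re z + 1)\<^sup>2 - (Im z)\<^sup>2 = 1 / 2"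
  shows "1 < cmod (z + 2) \<longleftrightarrow> Re z \<notin> {(- 3 - sqrt 2) / 2 .. (- 2 - sqrt 2) / 2}"
proof -
  have "(sqrt 2)\<^sup>2 \<le> (2 * (Re z + 1))\<^sup>2"
  proof -
    have "0 \<le> (Im z)\<^sup>2" by simp
    then have "1 / 2 \<le> (Re z + 1)\<^sup>2" using assms by linarith
    then show ?thesis unfolding power_mult_distrib by simp
  qed
  then have a: "sqrt 2 \<le> \<bar>2 * (Re z + 1)\<bar>"
    using abs_le_square_iff[of "sqrt 2" "2 * (Re z + 1)"] by simp
  have "2 * (cmod (z + 2))\<^sup>2 - 2 = (2 * (Re z + 1) + 1)\<^sup>2 - 2"
    unfolding cmod_squares using assms by algebra
  moreover have "1 < cmod (z + 2) \<longleftrightarrow> 1\<^sup>2 < (cmod (z + 2))\<^sup>2"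
    by (rule less_iff_sq_less) auto
  ultimately have "1 < cmod (z + 2) \<longleftrightarrow> sqrt 2 < \<bar>2 * (Re z + 1) + 1\<bar>"
    using sq_greater_2_iff[of "2 * (Re z + 1) + 1"] by (simp; linarith)
  moreover have "Re z \<in> {(- 3 - sqrt 2) / 2 .. (- 2 - sqrt 2) / 2} \<longleftrightarrow>
      - 3 - sqrt 2 \<le> 2 * Re z \<and> 2 * Re z \<le> - 2 - sqrt 2" by auto
  ultimately show ?thesis using a sqrt2_bounds by argo
qed

text \<open>The curve is parametrised by r = |z|: both Re z and |z + 2| are functions of r, and each
  side of the equivalence amounts to r being at least 1 + \<open>sqrt 2\<close>.\<close>

lemma quartic_le_iff:
  assumes "(cmod (z + 1))\<^sup>2 = cmod z"
  shows "cmod (z + 2) \<le> 1 \<longleftrightarrow> Re z \<le> - 3 / 2 - sqrt 2 / 2"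
proof -
  define r where "r = cmod z"
  have r0: "0 \<le> r" by (simp add: r_def)
  have x: "2 * Re z = r - r\<^sup>2 - 1"
    using assms cmod_power2[of z] unfolding r_def cmod_power2[of "z + 1"]
    by (simp add: power2_eq_square algebra_simps)
  have "(cmod (z + 2))\<^sup>2 = 3 - (r - 1)\<^sup>2"
    using x cmod_power2[of z] unfolding r_def cmod_power2[of "z + 2"]
    by (simp add: power2_eq_square algebra_simps)
  moreover have "cmod (z + 2) \<le> 1 \<longleftrightarrow> (cmod (z + 2))\<^sup>2 \<le> 1\<^sup>2"
    by (rule power_mono_iff[symmetric]) auto
  ultimately have "cmod (z + 2) \<le> 1 \<longleftrightarrow> sqrt 2 \<le> \<bar>r - 1\<bar>"
    using sq_less_2_iff[of "r - 1"] by (simp; linarith)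
  then have "cmod (z + 2) \<le> 1 \<longleftrightarrow> 1 + sqrt 2 \<le> r"
    using r0 sqrt2_bounds by linarith
  also have "\<dots> \<longleftrightarrow> Re z \<le> - 3 / 2 - sqrt 2 / 2"
  proof -
    \<comment> \<open>The second factor is positive, so the sign is that of 1 +
      \<open>sqrt 2\<close> - r.\<close>
    have "2 * Re z - 2 * (- 3 / 2 - sqrt 2 / 2) = ((1 + sqrt 2) - r) * (r + sqrt 2)"
      using x by (simp add: algebra_simps power2_eq_square)
    moreover have "0 < r + sqrt 2" using r0 sqrt2_bounds by linarith
    ultimately have "0 < 2 * Re z - 2 * (- 3 / 2 - sqrt 2 / 2) \<longleftrightarrow> 0 < (1 + sqrt 2) - r"
      by (simp add: zero_less_mult_iff)
    then show ?thesis by argo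
  qed
  finally show ?thesis .
qed

section \<open>Accumulation of roots on each curve\<close>

lemma circle_islimpt:
  assumes z: "cmod (z + 2) = 1" "(cmod (z + 1))\<^sup>2 < cmod z"
  shows "z islimpt book_roots"
proof (rule islimpt_book_roots)
  fix e :: real assume "e > 0"
  have "open {w. (cmod (w + 1))\<^sup>2 < cmod w}"
    by (intro open_Collect_less continuous_intros)
  then obtain \<delta> where "\<delta> > 0" and \<delta>: "\<And>w. dist w z < \<delta> \<Longrightarrow> (cmod (w + 1))\<^sup>2 < cmod w"
    using z by (auto simp: open_dist)
  \<comment> \<open>Small enough for both neighbourhoods, and below 1 so that |1 - t| = 1 -
    t.\<close>
  define t where "t = min 1 (min e \<delta>) / 2"
  have t: "0 < t" "t < 1" "t < e" "t < \<delta>" using \<open>e > 0\<close> \<open>\<delta> > 0\<close> by (auto simp: t_def min_def)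
  \<comment> \<open>Moving along the ray from the centre -2 through \<open>z\<close> crosses the
    circle: base 1 dominates outside and base 2 inside, while base 0 stays below.\<close>
  define w where "w = (\<lambda>s. z + of_real s * (z + 2))"
  have dist: "dist (w s) z = \<bar>s\<bar>" for s using z by (simp add: w_def dist_norm norm_mult)
  have w2: "cmod (w s + 2) = \<bar>1 + s\<bar>" for s
  proof -
    have "w s + 2 = of_real (1 + s) * (z + 2)" by (simp add: w_def algebra_simps)
    then show ?thesis using z by (metis norm_mult norm_of_real mult.right_neutral)
  qed
  have "book_dominates 1 (w t)"
  proof (rule book_dominates_1)
    have *: "(cmod (w t + 1))\<^sup>2 < cmod (w t)" using \<delta> dist t by simp
    then show "w t \<noteq> 0" by auto
    show "1 < cmod (w t + 2)" using w2 t by simp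
    then have "cmod (w t) \<le> cmod (w t) * cmod (w t + 2)"
      by (metis less_eq_real_def mult_left_mono mult.right_neutral norm_ge_zero)
    then show "(cmod (w t + 1))\<^sup>2 < cmod (w t) * cmod (w t + 2)" using * by linarith
  qed
  moreover have "book_dominates 2 (w (- t))"
    using \<delta> dist w2 t by (intro book_dominates_2) auto
  ultimately show "\<exists>i j a b. i \<noteq> j \<and> dist a z < e \<and> book_dominates i a \<and> dist b z < e \<and> book_dominates j b"
    using dist t by (intro exI[of _ 1] exI[of _ 2] exI[of _ "w t"] exI[of _ "w (- t)"]) auto
qed

lemma hyperbola_islimpt:
  assumes z: "(Re z + 1)\<^sup>2 - (Im z)\<^sup>2 = 1 / 2" "1 < cmod (z + 2)"
  shows "z islimpt book_roots"
proof (rule islimpt_book_roots)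
  fix e :: real assume "e > 0"
  have "z \<noteq> 0" using z by auto
  have "open {w. 1 < cmod (w + 2)}"
    by (intro open_Collect_less continuous_intros)
  then have "open ({w. 1 < cmod (w + 2)} - {0})" by (intro open_Diff) auto
  then obtain \<delta> where "\<delta> > 0" and \<delta>: "\<And>w. dist w z < \<delta> \<Longrightarrow> 1 < cmod (w + 2) \<and> w \<noteq> 0"
    using z \<open>z \<noteq> 0\<close> by (auto simp: open_dist)
  define A where "A = Re z + 1"
  have A0: "A \<noteq> 0"
  proof
    assume "A = 0"
    then have "- (Im z)\<^sup>2 = 1 / 2" using z(1) by (simp add: A_def)
    then show False using zero_le_power2[of "Im z"] by linarith
  qed
  \<comment> \<open>With t < |A| the factor 2|A| + s in \<open>h\<close> is positive for s = t and s
    = -t, so the sign of s decides the side of the hyperbola.\<close>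
  define t where "t = min \<bar>A\<bar> (min e \<delta>) / 2"
  have t: "0 < t" "t < \<bar>A\<bar>" "t < e" "t < \<delta>" using \<open>e > 0\<close> \<open>\<delta> > 0\<close> A0 by (auto simp: t_def min_def)
  \<comment> \<open>A horizontal move; the factor \<open>sgn A\<close> makes positive s point away
    from the axis Re = -1.\<close>
  define w where "w = (\<lambda>s. z + of_real (s * sgn A))"
  have dist: "dist (w s) z = \<bar>s\<bar>" for s
    using A0 by (simp add: w_def dist_norm norm_mult abs_sgn_eq)
  have h: "(Re (w s) + 1)\<^sup>2 - (Im (w s))\<^sup>2 = 1 / 2 + s * (2 * \<bar>A\<bar> + s)" for s
  proof -
    have "(Re (w s) + 1)\<^sup>2 - (Im (w s))\<^sup>2 = (A + s * sgn A)\<^sup>2 - (Im z)\<^sup>2"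
      by (simp add: w_def A_def algebra_simps)
    also have "\<dots> = A\<^sup>2 - (Im z)\<^sup>2 + s * (2 * (A * sgn A) + s * (sgn A * sgn A))"
      by (simp add: algebra_simps power2_eq_square)
    also have "\<dots> = 1 / 2 + s * (2 * \<bar>A\<bar> + s)"
      using z(1) A0 by (simp add: A_def abs_sgn[symmetric] sgn_mult[symmetric])
    finally show ?thesis .
  qed
  have "book_dominates 0 (w t)"
  proof (rule book_dominates_0)
    show *: "cmod (w t) * cmod (w t + 2) < (cmod (w t + 1))\<^sup>2"
      unfolding base01_less_iff h using t by simp
    have "1 < cmod (w t + 2)" using \<delta> dist t by simp
    then have "cmod (w t) \<le> cmod (w t) * cmod (w t + 2)"
      by (metis less_eq_real_def mult_left_mono mult.right_neutral norm_ge_zero)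
    then show "cmod (w t) < (cmod (w t + 1))\<^sup>2" using * by linarith
    show "w t \<noteq> 0" using \<delta> dist t by simp
  qed
  moreover have "book_dominates 1 (w (- t))"
  proof (rule book_dominates_1)
    show "(cmod (w (- t) + 1))\<^sup>2 < cmod (w (- t)) * cmod (w (- t) + 2)"
      unfolding base01_less_iff h using t by (simp add: mult_less_0_iff)
  qed (use \<delta> dist t in auto)
  ultimately show "\<exists>i j a b. i \<noteq> j \<and> dist a z < e \<and> book_dominates i a \<and> dist b z < e \<and> book_dominates j b"
    using dist t by (intro exI[of _ 0] exI[of _ 1] exI[of _ "w t"] exI[of _ "w (- t)"]) auto
qed

lemma quartic_islimpt:
  assumes z: "(cmod (z + 1))\<^sup>2 = cmod z" "cmod (z + 2) < 1"
  shows "z islimpt book_roots"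
proof (rule islimpt_book_roots)
  fix e :: real assume "e > 0"
  have "open {w. cmod (w + 2) < 1}"
    by (intro open_Collect_less continuous_intros)
  then obtain \<delta> where "\<delta> > 0" and \<delta>: "\<And>w. dist w z < \<delta> \<Longrightarrow> cmod (w + 2) < 1"
    using z by (auto simp: open_dist)
  define r where "r = cmod z"
  have r: "1 < r" using z(2) norm_triangle_ineq4[of "z + 2" z] by (simp add: r_def)
  \<comment> \<open>Division by r compensates for the distance |s| r in \<open>dist\<close>. The
    bound t r < r - 1 keeps the bracket in \<open>h\<close> positive for s = -t.\<close>
  define t where "t = min (r - 1) (min e \<delta>) / 2 / r"
  have "t * r = min (r - 1) (min e \<delta>) / 2" using r by (simp add: t_def)
  then have t: "0 < t" "t * r < r - 1" "t * r < e" "t * r < \<delta>"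
    using r \<open>e > 0\<close> \<open>\<delta> > 0\<close> by (auto simp: t_def)
  have "t < 1" using t r by (smt (verit) mult_le_cancel_right1)
  \<comment> \<open>Scaling from the origin crosses the curve transversally since r > 1: base 0
    dominates beyond it and base 2 before it.\<close>
  define w where "w = (\<lambda>s. of_real (1 + s) * z)"
  have dist: "dist (w s) z = \<bar>s\<bar> * r" for s
  proof -
    have "w s - z = of_real s * z" by (simp add: w_def algebra_simps)
    then show ?thesis by (simp add: dist_norm norm_mult r_def)
  qed
  have h: "(cmod (w s + 1))\<^sup>2 - cmod (w s) = s * (r\<^sup>2 - 1 + s * r\<^sup>2)" if "\<bar>s\<bar> < 1" for s
  proof -
    have "cmod (w s) = (1 + s) * r" using that by (simp add: w_def norm_mult r_def del: of_real_add)
    moreover have "(cmod (w s + 1))\<^sup>2 = ((1 + s) * Re z + 1)\<^sup>2 + ((1 + s) * Im z)\<^sup>2"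
      unfolding cmod_squares by (simp add: w_def algebra_simps)
    moreover have "r\<^sup>2 = (Re z)\<^sup>2 + (Im z)\<^sup>2" "(Re z + 1)\<^sup>2 + (Im z)\<^sup>2 = r"
      using z cmod_power2[of z] cmod_power2[of "z + 1"] by (simp_all add: r_def)
    ultimately show ?thesis by algebra
  qed
  have "book_dominates 0 (w t)"
  proof (rule book_dominates_0)
    have "0 < r\<^sup>2 - 1 + t * r\<^sup>2" using r t by (simp add: add_pos_pos)
    then have "0 < t * (r\<^sup>2 - 1 + t * r\<^sup>2)" using t by simp
    then show *: "cmod (w t) < (cmod (w t + 1))\<^sup>2"
      using h[of t] t \<open>t < 1\<close> by linarith
    have "cmod (w t + 2) < 1" using \<delta> dist t by simp
    then have "cmod (w t) * cmod (w t + 2) \<le> cmod (w t)"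
      by (metis less_eq_real_def mult_left_mono mult.right_neutral norm_ge_zero)
    then show "cmod (w t) * cmod (w t + 2) < (cmod (w t + 1))\<^sup>2" using * by linarith
    show "w t \<noteq> 0" using \<open>cmod (w t + 2) < 1\<close> by auto
  qed
  moreover have "book_dominates 2 (w (- t))"
  proof (rule book_dominates_2)
    have "t * r * r < (r - 1) * r" using t r by simp
    also have "\<dots> < r\<^sup>2 - 1" using r by (simp add: algebra_simps power2_eq_square)
    finally have "0 < r\<^sup>2 - 1 + (- t) * r\<^sup>2" by (simp add: algebra_simps power2_eq_square)
    then have "(- t) * (r\<^sup>2 - 1 + (- t) * r\<^sup>2) < 0" using t by (intro mult_neg_pos) auto
    then show "(cmod (w (- t) + 1))\<^sup>2 < cmod (w (- t))"
      using h[of "- t"] t \<open>t < 1\<close> by linarith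
  qed (use \<delta> dist t in auto)
  ultimately show "\<exists>i j a b. i \<noteq> j \<and> dist a z < e \<and> book_dominates i a \<and> dist b z < e \<and> book_dominates j b"
    using dist t by (intro exI[of _ 0] exI[of _ 2] exI[of _ "w t"] exI[of _ "w (- t)"]) auto
qed

text \<open>At the points where all three bases have equal modulus, the set of limit points being closed
  reduces the claim to nearby points of the circle.\<close>

lemma triple_point_islimpt:
  assumes z: "cmod (z + 2) = 1" "Re z = - 3 / 2 - sqrt 2 / 2"
  shows "z islimpt book_roots"
proof -
  \<comment> \<open>The imaginary part that puts the point with real part Re z + s on the same half
    of the circle as \<open>z\<close>.\<close>
  define y where "y = (\<lambda>s. sgn (Im z) * sqrt (1 - (Re z + s + 2)\<^sup>2))"
  define w where "w = (\<lambda>n. Complex (Re z + 1 / real (Suc n)) (y (1 / real (Suc n))))"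
  have one: "(Re z + 2)\<^sup>2 + (Im z)\<^sup>2 = 1"
    using z cmod_power2[of "z + 2"] by simp
  have "sqrt (1 - (Re z + 2)\<^sup>2) = \<bar>Im z\<bar>"
    using one by (simp add: real_sqrt_abs[symmetric] del: real_sqrt_abs)
  then have y0: "y 0 = Im z" by (simp add: y_def sgn_mult_abs)
  have lim: "(\<lambda>n. 1 / real (Suc n)) \<longlonglongrightarrow> 0"
    using LIMSEQ_inverse_real_of_nat by (simp add: inverse_eq_divide)
  have "isCont y 0" unfolding y_def by (intro continuous_intros)
  then have "(\<lambda>n. y (1 / real (Suc n))) \<longlonglongrightarrow> y 0"
    using lim by (rule isCont_tendsto_compose)
  then have "w \<longlonglongrightarrow> Complex (Re z + 0) (y 0)"
    unfolding w_def by (intro tendsto_Complex tendsto_intros lim)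
  then have lim_w: "w \<longlonglongrightarrow> z" by (simp add: y0)
  have "w n \<in> {x. x islimpt book_roots}" for n
  proof -
    define s where "s = 1 / real (Suc n)"
    have s: "0 < s" "s \<le> 1" by (auto simp: s_def)
    have w: "w n = Complex (Re z + s) (y s)" by (simp only: w_def s_def)
    \<comment> \<open>Re z + 2 lies strictly between -1 and 0, so a shift by at most 1 keeps the
      square root real.\<close>
    have "\<bar>Re z + s + 2\<bar> \<le> 1" using z s sqrt2_bounds unfolding abs_le_iff by linarith
    then have le: "(Re z + s + 2)\<^sup>2 \<le> 1" by (simp add: abs_square_le_1)
    have "Im z \<noteq> 0"
    proof
      assume "Im z = 0"
      then have "Re z + 2 = 1 \<or> Re z + 2 = - 1" using one by (simp add: power2_eq_1_iff)
      then show False using z sqrt2_bounds by linarith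
    qed
    then have "(sgn (Im z))\<^sup>2 = 1" by (simp add: sgn_if)
    then have "(y s)\<^sup>2 = 1 - (Re z + s + 2)\<^sup>2"
      using le by (simp add: y_def power_mult_distrib)
    then have "(cmod (w n + 2))\<^sup>2 = 1"
      unfolding cmod_squares by (simp add: w)
    then have "cmod (w n + 2) = 1" by (simp add: power2_eq_1_iff) (smt (verit) norm_ge_zero)
    moreover have "- 3 / 2 - sqrt 2 / 2 < Re (w n)" using z s by (simp add: w)
    ultimately show ?thesis using circle_islimpt circle_less_iff by blast
  qed
  from closed_sequentially[OF closed_limpts this lim_w] show ?thesis by simp
qed

text \<open>The singleton \<open>{0}\<close> carries the common root of all the polynomials, which
  lies on none of the three curves.\<close>

theorem theorem3p7:
  shows "{z. limit_of_roots (\<lambda>n. domination_poly (book5 n)) z} =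
      {z. cmod (z + 2) = 1 \<and> Re z \<ge> - 3 / 2 - sqrt 2 / 2}
    \<union> {z. (Re z + 1)\<^sup>2 - (Im z)\<^sup>2 = 1 / 2 \<and> Re z \<notin> {(- 3 - sqrt 2) / 2 .. (- 2 - sqrt 2) / 2}}
    \<union> {z. (cmod (z + 1))\<^sup>2 = cmod z \<and> Re z \<le> - 3 / 2 - sqrt 2 / 2}
    \<union> {0}"
    (is "?L = ?C \<union> ?H \<union> ?Q \<union> {0}")
proof (intro equalityI subsetI)
  fix z assume "z \<in> ?L"
  then have not_dom: "\<not> book_dominates i z" for i
    using not_limit_of_roots_book5[of i z] by blast
  show "z \<in> ?C \<union> ?H \<union> ?Q \<union> {0}"
  \<comment> \<open>At 0 all three coefficients vanish, so exclusion by dominance is available only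
    elsewhere.\<close>
  proof (cases "z = 0")
    case False
    then have "0 < cmod z" by simp
    \<comment> \<open>The cases say which of bases 1 and 2 is larger; base 0 then has to tie with
      the larger one, or on the circle must not exceed their common modulus.\<close>
    consider "cmod (z + 2) = 1" | "1 < cmod (z + 2)" | "cmod (z + 2) < 1" by linarith
    then show ?thesis
    proof cases
      case 1
      then have "\<not> cmod z < (cmod (z + 1))\<^sup>2"
        using book_dominates_0[OF False] not_dom[of 0] by auto
      then have "z \<in> ?C" using circle_less_iff(2)[OF 1] 1 by auto
      then show ?thesis by blast
    next
      case 2
      then have "cmod z < cmod z * cmod (z + 2)" using \<open>0 < cmod z\<close> by simp
      then have "\<not> cmod z * cmod (z + 2) < (cmod (z + 1))\<^sup>2"
        using book_dominates_0[OF False] not_dom[of 0] by linarith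
      moreover have "\<not> (cmod (z + 1))\<^sup>2 < cmod z * cmod (z + 2)"
        using book_dominates_1[OF False] not_dom[of 1] 2 by blast
      ultimately have "(Re z + 1)\<^sup>2 - (Im z)\<^sup>2 = 1 / 2"
        unfolding base01_less_iff by linarith
      then have "z \<in> ?H" using hyperbola_greater_iff 2 by simp
      then show ?thesis by blast
    next
      case 3
      then have "cmod z * cmod (z + 2) < cmod z" using \<open>0 < cmod z\<close> by simp
      then have "\<not> cmod z < (cmod (z + 1))\<^sup>2"
        using book_dominates_0[OF False] not_dom[of 0] by linarith
      moreover have "\<not> (cmod (z + 1))\<^sup>2 < cmod z"
        using book_dominates_2[of z] not_dom[of 2] 3 by blast
      ultimately have "(cmod (z + 1))\<^sup>2 = cmod z" by linarith
      then have "z \<in> ?Q" using quartic_le_iff[of z] 3 by simp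
      then show ?thesis by blast
    qed
  qed simp
next
  fix z assume "z \<in> ?C \<union> ?H \<union> ?Q \<union> {0}"
  moreover have lim: "z \<in> ?L" if "z islimpt book_roots"
    using that by (simp only: limit_of_roots_def mem_Collect_eq simp_thms)
  have circle: "z \<in> ?L" if z: "z \<in> ?C"
  proof (cases "Re z = - 3 / 2 - sqrt 2 / 2")
    case True
    then show ?thesis using z by (intro lim triple_point_islimpt) simp_all
  next
    case False
    then show ?thesis using z circle_less_iff(1)[of z] by (intro lim circle_islimpt) simp_all
  qed
  moreover have "z \<in> ?L" if z: "z \<in> ?H"
    using z hyperbola_greater_iff[of z] by (intro lim hyperbola_islimpt) simp_all
  moreover have "z \<in> ?L" if z: "z \<in> ?Q"
  \<comment> \<open>An endpoint of this curve that lies on the circle is a triple point and is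
    covered by the circle case.\<close>
  proof (cases "cmod (z + 2) = 1")
    case True
    then show ?thesis using z circle_less_iff(2)[OF True] by (intro circle) simp
  next
    case False
    then show ?thesis using z quartic_le_iff[of z] by (intro lim quartic_islimpt) simp_all
  qed
  moreover have "z \<in> ?L" if "z \<in> {0}"
    using that limit_of_roots_book5_zero by (simp only: mem_Collect_eq singleton_iff)
  ultimately show "z \<in> ?L" by (elim UnE)
qed

end
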